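(* Let $a$ be a real number, let $n \ge 0$ be an integer, and let $F_n$ be the $n$-th Fibonacci octonion in the generalized octonion algebra $\mathcal{O}_{\mathbb{R}}(a+1, 2a+1, 3a+1)$. Then the norm of $F_n$ in $\mathcal{O}_{\mathbb{R}}(a+1,2a+1,3a+1)$ is $$n(F_n) = f_{2n+6}\left(79a^2 + 46a + \frac{174a^3 - 4a}{5}\right) + f_{2n+7}\left(130a^2 + 84a + 21 + \frac{282a^3 + 8a}{5}\right) + (-1)^n\left(4a^2 + \frac{12a^3 + 8a}{5}\right).$$
   Context: The Fibonacci sequence $(f_n)_{n\ge 0}$ is defined by $f_0=0$, $f_1=1$, $f_n=f_{n-1}+f_{n-2}$ for $n\ge 2$. For real $\alpha,\beta,\gamma$, the generalized octonion algebra $\mathcal{O}_{\mathbb{R}}(\alpha,\beta,\gamma)$ is the 8-dimensional real algebra with basis $\{1,e_1,\dots,e_7\}$, where $1$ is the identity, with squares $e_1^2=-\alpha$, $e_2^2=-\beta$, $e_3^2=-\alpha\beta$, $e_4^2=-\gamma$, $e_5^2=-\alpha\gamma$, $e_6^2=-\beta\gamma$, $e_7^2=-\alpha\beta\gamma$, with $e_ie_j=-e_je_i$ for $i\ne j$, and with $e_1e_2=e_3$, $e_1e_3=-\alpha e_2$, $e_1e_4=e_5$, $e_1e_5=-\alpha e_4$, $e_1e_6=-e_7$, $e_1e_7=\alpha e_6$, $e_2e_3=\beta e_1$, $e_2e_4=e_6$, $e_2e_5=e_7$, $e_2e_6=-\beta e_4$, $e_2e_7=-\beta e_5$, $e_3e_4=e_7$,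 $e_3e_5=-\alpha e_6$, $e_3e_6=\beta e_5$, $e_3e_7=-\alpha\beta e_4$, $e_4e_5=\gamma e_1$, $e_4e_6=\gamma e_2$, $e_4e_7=\gamma e_3$, $e_5e_6=-\gamma e_3$, $e_5e_7=\alpha\gamma e_2$, $e_6e_7=-\beta\gamma e_1$. For $x=x_0+x_1e_1+\dots+x_7e_7$ with $x_i \in \mathbb{R}$, the conjugate is $\overline{x}=x_0-x_1e_1-\dots-x_7e_7$ and the norm is $n(x)=x\overline{x}=x_0^2+\alpha x_1^2+\beta x_2^2+\alpha\beta x_3^2+\gamma x_4^2+\alpha\gamma x_5^2+\beta\gamma x_6^2+\alpha\beta\gamma x_7^2\in\mathbb{R}$. (The symbol $n(\cdot)$ denotes the norm, while $n$ as an index is an integer.) The $n$-th Fibonacci octonion ($n\ge 0$) is $F_n=f_n+f_{n+1}e_1+f_{n+2}e_2+f_{n+3}e_3+f_{n+4}e_4+f_{n+5}e_5+f_{n+6}e_6+f_{n+7}e_7$. *)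

theory Defs
  imports "HOL-Analysis.Finite_Cartesian_Product" "HOL-Number_Theory.Fib"
begin

text \<open>
  The underlying real vector space of every generalized octonion algebra is \<open>real ^ 8\<close>.
  Its index type \<open>8\<close> is the ring of integers modulo 8, so \<open>oct_e 0, \<dots>, oct_e 7\<close> are
  eight distinct unit vectors; \<open>oct_e 0\<close> plays the role of the identity \<open>1\<close>.
\<close>

definition oct_e :: "nat \<Rightarrow> real ^ 8" where
  "oct_e k = axis (of_nat k) 1"

definition oct_coord :: "real ^ 8 \<Rightarrow> nat \<Rightarrow> real" where
  "oct_coord x k = x $ of_nat k"

text \<open>Entry \<open>j\<close> of row \<open>i\<close> is the product \<open>e\<^sub>i e\<^sub>j\<close>, for \<open>i, j = 0, \<dots>, 7\<close>.\<close>

definition oct_table :: "real \<Rightarrow> real \<Rightarrow> real \<Rightarrow> (real ^ 8) list list" where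
  "oct_table \<alpha> \<beta> \<gamma> =
    [[oct_e 0, oct_e 1, oct_e 2, oct_e 3, oct_e 4, oct_e 5, oct_e 6, oct_e 7],
     [oct_e 1, (-\<alpha>) *\<^sub>R oct_e 0, oct_e 3, (-\<alpha>) *\<^sub>R oct_e 2,
      oct_e 5, (-\<alpha>) *\<^sub>R oct_e 4, - oct_e 7, \<alpha> *\<^sub>R oct_e 6],
     [oct_e 2, - oct_e 3, (-\<beta>) *\<^sub>R oct_e 0, \<beta> *\<^sub>R oct_e 1,
      oct_e 6, oct_e 7, (-\<beta>) *\<^sub>R oct_e 4, (-\<beta>) *\<^sub>R oct_e 5],
     [oct_e 3, \<alpha> *\<^sub>R oct_e 2, (-\<beta>) *\<^sub>R oct_e 1, (-(\<alpha>*\<beta>)) *\<^sub>R oct_e 0,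
      oct_e 7, (-\<alpha>) *\<^sub>R oct_e 6, \<beta> *\<^sub>R oct_e 5, (-(\<alpha>*\<beta>)) *\<^sub>R oct_e 4],
     [oct_e 4, - oct_e 5, - oct_e 6, - oct_e 7,
      (-\<gamma>) *\<^sub>R oct_e 0, \<gamma> *\<^sub>R oct_e 1, \<gamma> *\<^sub>R oct_e 2, \<gamma> *\<^sub>R oct_e 3],
     [oct_e 5, \<alpha> *\<^sub>R oct_e 4, - oct_e 7, \<alpha> *\<^sub>R oct_e 6,
      (-\<gamma>) *\<^sub>R oct_e 1, (-(\<alpha>*\<gamma>)) *\<^sub>R oct_e 0, (-\<gamma>) *\<^sub>R oct_e 3, (\<alpha>*\<gamma>) *\<^sub>R oct_e 2],
     [oct_e 6, oct_e 7, \<beta> *\<^sub>R oct_e 4, (-\<beta>) *\<^sub>R oct_e 5,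
      (-\<gamma>) *\<^sub>R oct_e 2, \<gamma> *\<^sub>R oct_e 3, (-(\<beta>*\<gamma>)) *\<^sub>R oct_e 0, (-(\<beta>*\<gamma>)) *\<^sub>R oct_e 1],
     [oct_e 7, (-\<alpha>) *\<^sub>R oct_e 6, \<beta> *\<^sub>R oct_e 5, (\<alpha>*\<beta>) *\<^sub>R oct_e 4,
      (-\<gamma>) *\<^sub>R oct_e 3, (-(\<alpha>*\<gamma>)) *\<^sub>R oct_e 2, (\<beta>*\<gamma>) *\<^sub>R oct_e 1, (-(\<alpha>*\<beta>*\<gamma>)) *\<^sub>R oct_e 0]]"

definition oct_mult :: "real \<Rightarrow> real \<Rightarrow> real \<Rightarrow> real ^ 8 \<Rightarrow> real ^ 8 \<Rightarrow> real ^ 8" where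
  "oct_mult \<alpha> \<beta> \<gamma> x y =
    (\<Sum>i<8. \<Sum>j<8. (oct_coord x i * oct_coord y j) *\<^sub>R (oct_table \<alpha> \<beta> \<gamma> ! i ! j))"

definition oct_cnj :: "real ^ 8 \<Rightarrow> real ^ 8" where
  "oct_cnj x = oct_coord x 0 *\<^sub>R oct_e 0 - (\<Sum>k=1..7. oct_coord x k *\<^sub>R oct_e k)"

text \<open>The real number \<open>r\<close> with \<open>x \<cdot> cnj x = r \<cdot> 1\<close>; existence and uniqueness are shown below.\<close>

definition oct_norm :: "real \<Rightarrow> real \<Rightarrow> real \<Rightarrow> real ^ 8 \<Rightarrow> real" where
  "oct_norm \<alpha> \<beta> \<gamma> x = (THE r. oct_mult \<alpha> \<beta> \<gamma> x (oct_cnj x) = r *\<^sub>R oct_e 0)"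

definition fib_oct :: "nat \<Rightarrow> real ^ 8" where
  "fib_oct n = (\<Sum>k<8. real (fib (n + k)) *\<^sub>R oct_e k)"

lemma lessThan_8: "{..<8::nat} = {0,1,2,3,4,5,6,7}"
  by auto

lemma oct_coord_e:
  assumes "i < 8" "j < 8"
  shows "oct_coord (oct_e i) j = (if i = j then 1 else 0)"
proof -
  have "(of_nat i :: 8) = of_nat j \<longleftrightarrow> i = j"
    using assms unfolding lessThan_iff[symmetric] lessThan_8 by auto
  then show ?thesis
    by (auto simp: oct_coord_def oct_e_def axis_def)
qed

lemma oct_coord_lin [simp]:
  "oct_coord (x + y) k = oct_coord x k + oct_coord y k"
  "oct_coord (x - y) k = oct_coord x k - oct_coord y k"
  "oct_coord (- x) k = - oct_coord x k"
  "oct_coord (c *\<^sub>R x) k = c * oct_coord x k"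
  by (simp_all add: oct_coord_def)

lemma oct_coord_sum: "oct_coord (\<Sum>i\<in>A. f i) k = (\<Sum>i\<in>A. oct_coord (f i) k)"
  by (simp add: oct_coord_def)

lemma oct_coord_cnj:
  assumes "k < 8"
  shows "oct_coord (oct_cnj x) k = (if k = 0 then oct_coord x 0 else - oct_coord x k)"
proof -
  have "(\<Sum>i=1..7. oct_coord x i * oct_coord (oct_e i) k)
      = (\<Sum>i=1..7. if i = k then oct_coord x i else 0)"
    using assms by (intro sum.cong refl) (auto simp: oct_coord_e)
  then show ?thesis
    using assms by (auto simp: oct_cnj_def oct_coord_sum oct_coord_e)
qed

lemma oct_mult_e:
  assumes "i < 8" "j < 8"
  shows "oct_mult \<alpha> \<beta> \<gamma> (oct_e i) (oct_e j) = oct_table \<alpha> \<beta> \<gamma> ! i ! j"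
proof -
  have "(\<Sum>j'<8. (oct_coord (oct_e i) i' * oct_coord (oct_e j) j') *\<^sub>R (oct_table \<alpha> \<beta> \<gamma> ! i' ! j'))
      = (if i' = i then oct_table \<alpha> \<beta> \<gamma> ! i ! j else 0)" if "i' < 8" for i'
  proof -
    have "(\<Sum>j'<8. (oct_coord (oct_e i) i' * oct_coord (oct_e j) j') *\<^sub>R (oct_table \<alpha> \<beta> \<gamma> ! i' ! j'))
        = (\<Sum>j'<8. if j' = j then if i' = i then oct_table \<alpha> \<beta> \<gamma> ! i ! j else 0 else 0)"
      using assms that by (intro sum.cong refl) (auto simp: oct_coord_e)
    then show ?thesis
      using assms by simp
  qed
  then have "oct_mult \<alpha> \<beta> \<gamma> (oct_e i) (oct_e j) =
      (\<Sum>i'<8. if i' = i then oct_table \<alpha> \<beta> \<gamma> ! i ! j else 0)"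
    unfolding oct_mult_def by (intro sum.cong refl) simp
  then show ?thesis
    using assms by simp
qed

lemma oct_e_anticommute:
  assumes "i \<in> {1..7}" "j \<in> {1..7}" "i \<noteq> j"
  shows "oct_mult \<alpha> \<beta> \<gamma> (oct_e i) (oct_e j) = - oct_mult \<alpha> \<beta> \<gamma> (oct_e j) (oct_e i)"
proof -
  have "i \<in> {1,2,3,4,5,6,7}" "j \<in> {1,2,3,4,5,6,7}"
    using assms by auto
  then have "oct_table \<alpha> \<beta> \<gamma> ! i ! j = - (oct_table \<alpha> \<beta> \<gamma> ! j ! i)"
    using assms(3) by (auto simp: oct_table_def)
  then show ?thesis
    using assms by (simp add: oct_mult_e)
qed

lemma oct_mult_cnj:
  "oct_mult \<alpha> \<beta> \<gamma> x (oct_cnj x) =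
    ((oct_coord x 0)\<^sup>2 + \<alpha> * (oct_coord x 1)\<^sup>2 + \<beta> * (oct_coord x 2)\<^sup>2 + \<alpha>*\<beta> * (oct_coord x 3)\<^sup>2
      + \<gamma> * (oct_coord x 4)\<^sup>2 + \<alpha>*\<gamma> * (oct_coord x 5)\<^sup>2 + \<beta>*\<gamma> * (oct_coord x 6)\<^sup>2
      + \<alpha>*\<beta>*\<gamma> * (oct_coord x 7)\<^sup>2) *\<^sub>R oct_e 0"
  by (simp add: oct_mult_def lessThan_8 oct_table_def oct_coord_cnj)
    (simp add: algebra_simps power2_eq_square)

lemma oct_norm_unique: "\<exists>!r. oct_mult \<alpha> \<beta> \<gamma> x (oct_cnj x) = r *\<^sub>R oct_e 0"
proof -
  have "oct_e 0 \<noteq> 0"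
    by (simp add: oct_e_def axis_eq_0_iff)
  then show ?thesis
    unfolding oct_mult_cnj by auto
qed

end

theory Submission
  imports Defs
begin

text \<open>
  The addition law expresses each of \<open>fib n, \<dots>, fib (n + 7)\<close> as a fixed integer combination of
  \<open>x = fib n\<close> and \<open>y = fib (n + 1)\<close>, so the norm of \<open>fib_oct n\<close>, a weighted sum of their squares,
  is a binary quadratic form in \<open>x\<close> and \<open>y\<close> whose coefficients are polynomials in \<open>a\<close>.
  The quantities on the right-hand side are integer quadratic forms in the same two variables:
  the doubling laws give \<open>fib (2 * n + 6)\<close> and \<open>fib (2 * n + 7)\<close>, and Cassini's identity gives
  \<open>(-1) ^ n = y\<^sup>2 - x * y - x\<^sup>2\<close>. The coefficient matrix of these three forms has
  determinant \<open>-5\<close>, so they are a basis of the real binary quadratic forms, and the coordinates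
  of the norm in that basis, with their denominators 5, are the claimed polynomials in \<open>a\<close>.
\<close>

lemma oct_norm_eq:
  "oct_norm \<alpha> \<beta> \<gamma> x =
    (oct_coord x 0)\<^sup>2 + \<alpha> * (oct_coord x 1)\<^sup>2 + \<beta> * (oct_coord x 2)\<^sup>2 + \<alpha>*\<beta> * (oct_coord x 3)\<^sup>2
      + \<gamma> * (oct_coord x 4)\<^sup>2 + \<alpha>*\<gamma> * (oct_coord x 5)\<^sup>2 + \<beta>*\<gamma> * (oct_coord x 6)\<^sup>2
      + \<alpha>*\<beta>*\<gamma> * (oct_coord x 7)\<^sup>2"
  unfolding oct_norm_def
  by (rule the1_equality[OF oct_norm_unique oct_mult_cnj])

lemma oct_coord_fib_oct:
  assumes "k < 8"
  shows "oct_coord (fib_oct n) k = real (fib (n + k))"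
proof -
  have "oct_coord (fib_oct n) k = (\<Sum>i<8. if i = k then real (fib (n + i)) else 0)"
    unfolding fib_oct_def oct_coord_sum
    using assms by (intro sum.cong refl) (auto simp: oct_coord_e)
  then show ?thesis
    using assms by simp
qed

lemma fib_double_quadratic:
  "fib (2 * n + 1) = (fib n)\<^sup>2 + (fib (n + 1))\<^sup>2"
  "fib (2 * n + 2) = 2 * fib n * fib (n + 1) + (fib (n + 1))\<^sup>2"
  using fib_add[of n n] fib_add[of n "Suc n"]
  by (simp_all add: mult_2 power2_eq_square distrib_left distrib_right)

lemma Cassini_quadratic:
  "(-1) ^ n = (real (fib (n + 1)))\<^sup>2 - real (fib n) * real (fib (n + 1)) - (real (fib n))\<^sup>2"
  by (induction n) (simp_all add: power2_eq_square algebra_simps)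

theorem proposition3p3:
  fixes a :: real and n :: nat
  shows "oct_norm (a + 1) (2 * a + 1) (3 * a + 1) (fib_oct n) =
      real (fib (2 * n + 6)) * (79 * a\<^sup>2 + 46 * a + (174 * a ^ 3 - 4 * a) / 5)
    + real (fib (2 * n + 7)) * (130 * a\<^sup>2 + 84 * a + 21 + (282 * a ^ 3 + 8 * a) / 5)
    + (-1) ^ n * (4 * a\<^sup>2 + (12 * a ^ 3 + 8 * a) / 5)"
proof -
  define x y where "x = real (fib n)" and "y = real (fib (n + 1))"
  have coord: "oct_coord (fib_oct n) 0 = x" "oct_coord (fib_oct n) 1 = y"
      "oct_coord (fib_oct n) 2 = x + y" "oct_coord (fib_oct n) 3 = x + 2 * y"
      "oct_coord (fib_oct n) 4 = 2 * x + 3 * y" "oct_coord (fib_oct n) 5 = 3 * x + 5 * y"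
      "oct_coord (fib_oct n) 6 = 5 * x + 8 * y" "oct_coord (fib_oct n) 7 = 8 * x + 13 * y"
    unfolding x_def y_def by (simp_all add: oct_coord_fib_oct numeral_eq_Suc)
  have double: "real (fib (2 * n + 1)) = x\<^sup>2 + y\<^sup>2" "real (fib (2 * n + 2)) = 2 * x * y + y\<^sup>2"
    unfolding x_def y_def fib_double_quadratic by simp_all
  have "fib (2 * n + 6) = 3 * fib (2 * n + 1) + 5 * fib (2 * n + 2)"
      "fib (2 * n + 7) = 5 * fib (2 * n + 1) + 8 * fib (2 * n + 2)"
    by (simp_all add: numeral_eq_Suc)
  then have right: "real (fib (2 * n + 6)) = 3 * x\<^sup>2 + 10 * x * y + 8 * y\<^sup>2"
      "real (fib (2 * n + 7)) = 5 * x\<^sup>2 + 16 * x * y + 13 * y\<^sup>2"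
    using double by simp_all
  have sign: "(-1) ^ n = y\<^sup>2 - x * y - x\<^sup>2"
    unfolding x_def y_def by (rule Cassini_quadratic)
  have norm: "oct_norm (a + 1) (2 * a + 1) (3 * a + 1) (fib_oct n) =
      x\<^sup>2 + (a + 1) * y\<^sup>2 + (2 * a + 1) * (x + y)\<^sup>2 + (a + 1) * (2 * a + 1) * (x + 2 * y)\<^sup>2
      + (3 * a + 1) * (2 * x + 3 * y)\<^sup>2 + (a + 1) * (3 * a + 1) * (3 * x + 5 * y)\<^sup>2
      + (2 * a + 1) * (3 * a + 1) * (5 * x + 8 * y)\<^sup>2
      + (a + 1) * (2 * a + 1) * (3 * a + 1) * (8 * x + 13 * y)\<^sup>2"
    unfolding oct_norm_eq coord ..
  show ?thesis
    unfolding norm right sign by (simp add: field_simps power2_eq_square power3_eq_cube)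
qed

end
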